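(* Let $d\ge 2$, let $f:\mathbb{R}^d\to\mathbb{R}$ be a $C^1$ function, and let $K_1,\dots,K_d\subset\mathbb{R}$ be Cantor sets (each given by a construction $K_i=\bigcap_{k\ge1}F_k^{(i)}$ as in the context), where the convex hull of $K_i$ is $[A_i,B_i]$. Suppose that for every $i\in\{1,\dots,d\}$ and every $(x_1,\dots,x_d)\in[A_1,B_1]\times\cdots\times[A_d,B_d]$ we have $$\partial_{x_i}f>0\quad\text{and}\quad s_{min}\Big(\sum_{j\neq i}(B_j-A_j)\,\partial_{x_j}f\Big)-\kappa\,(B_i-A_i)\,\partial_{x_i}f\ge 0$$ (all partial derivatives evaluated at $(x_1,\dots,x_d)$). Then $$f(K_1,K_2,\dots,K_d)=f(F_1^{(1)},F_1^{(2)},\dots,F_1^{(d)});$$ that is, $f(K_1,\dots,K_d)$ is a union of finitely many closed intervals.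
   Context: Cantor sets: start with a closed interval $F_0=[A,B]$. In the first step remove $n_1-1$ open intervals from $[A,B]$ so that $n_1\ge 2$ closed intervals remain; $F_1$ is the union of these. Inductively, given $F_k$ (a finite union of closed intervals), from each of its closed intervals remove finitely many (at least one) open intervals so that $m$ closed intervals remain after removing $m-1$ open ones ($m\ge2$ may depend on the interval); $F_{k+1}$ is the union of all remaining closed intervals. The set $K=\bigcap_{k\ge1}F_k$ is called a Cantor set; its convex hull is $[A,B]$. The deleted open intervals are the gaps of $K$, and the closed intervals making up each $F_k$, $k\ge1$, are the bridges of $K$. For a bridge $I$ of $F_k$, $k\ge1$, its father $\hat I$ is the unique interval of $F_{k-1}$ containing $I$. For a gap $G$ deleted in the $k$-th step, $k\ge1$, its father $\hat G$ is the unique interval of $F_{k-1}$ containing $G$. For Cantor sets $K_1,\dots,K_d$, write $F_k^{(i)}$ for the $k$-th stage of the construction of $K_i$ (so $F_1^{(i)}$ is the union of the first-step bridges of $K_i$). With $|\cdot|$ denoting length, $$s_{min}=\min_{1\le i\le d}\inf\{|I|/|\hat I|: I\text{ is a bridge of }K_i\},$$ $$\kappa=\max_{1\le i\le d}\sup\{|G|/|\hat G|: G\text{ is a gap of }K_i\text{ with }G\subset F_1^{(i)}\}$$ (so first-step gaps are not counted in $\kappa$). For sets $X_1,\dots,X_d\subset\mathbb{R}$, $f(X_1,\dots,X_d)=\{f(x_1,\dots,x_d):x_i\in X_i\}$. *)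

theory Defs
  imports "HOL-Analysis.Analysis"
begin

definition closed_interval :: "real set \<Rightarrow> bool" where
  "closed_interval I \<longleftrightarrow> (\<exists>a b. a < b \<and> I = {a..b})"

definition open_interval :: "real set \<Rightarrow> bool" where
  "open_interval U \<longleftrightarrow> (\<exists>a b. a < b \<and> U = {a<..<b})"

(* Removing the open intervals Us from I leaves exactly the closed intervals Js.
   The intervals in Js are required to be nondegenerate: in the construction each of them
   is split again, which is impossible for a single point. *)
definition splits :: "real set \<Rightarrow> real set set \<Rightarrow> real set set \<Rightarrow> bool" where
  "splits I Us Js \<longleftrightarrow>
     finite Us \<and> Us \<noteq> {} \<and> (\<forall>U\<in>Us. open_interval U \<and> U \<subseteq> I) \<and> disjoint Us \<and>
     finite Js \<and> (\<forall>J\<in>Js. closed_interval J) \<and> disjoint Js \<and>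
     card Js = card Us + 1 \<and> \<Union>Js = I - \<Union>Us"

(* F k is the collection of the closed intervals whose union is the k-th stage;
   G k, for k > 0, is the collection of the gaps deleted in the k-th step (G 0 is irrelevant). *)
definition cantor_construction ::
  "real \<Rightarrow> real \<Rightarrow> (nat \<Rightarrow> real set set) \<Rightarrow> (nat \<Rightarrow> real set set) \<Rightarrow> bool" where
  "cantor_construction A B F G \<longleftrightarrow>
     A < B \<and> F 0 = {{A..B}} \<and>
     (\<forall>k. \<exists>Us Js. (\<forall>I\<in>F k. splits I (Us I) (Js I)) \<and>
        F (Suc k) = (\<Union>I\<in>F k. Js I) \<and> G (Suc k) = (\<Union>I\<in>F k. Us I))"

definition cantor_set :: "(nat \<Rightarrow> real set set) \<Rightarrow> real set" where
  "cantor_set F = (\<Inter>k\<in>{1..}. \<Union>(F k))"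

(* The father of a bridge of F k, or of a gap deleted in the k-th step (k > 0). *)
definition father :: "(nat \<Rightarrow> real set set) \<Rightarrow> nat \<Rightarrow> real set \<Rightarrow> real set" where
  "father F k X = (THE J. J \<in> F (k - 1) \<and> X \<subseteq> J)"

abbreviation len :: "real set \<Rightarrow> real" where
  "len \<equiv> measure lborel"

definition s_min :: "('n::finite \<Rightarrow> nat \<Rightarrow> real set set) \<Rightarrow> real" where
  "s_min F = (MIN i. Inf {len I / len (father (F i) k I) | k I. k \<ge> 1 \<and> I \<in> F i k})"

(* The condition U \<subseteq> \<Union>(F i 1) excludes exactly the first-step gaps. *)
definition kappa ::
  "('n::finite \<Rightarrow> nat \<Rightarrow> real set set) \<Rightarrow> ('n \<Rightarrow> nat \<Rightarrow> real set set) \<Rightarrow> real" where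
  "kappa F G = (MAX i. Sup {len U / len (father (F i) k U) | k U.
     k \<ge> 1 \<and> U \<in> G i k \<and> U \<subseteq> \<Union>(F i 1)})"

definition partial :: "'n::finite \<Rightarrow> (real^'n \<Rightarrow> real) \<Rightarrow> real^'n \<Rightarrow> real" where
  "partial i f x = deriv (\<lambda>t. f (x + t *\<^sub>R axis i 1)) 0"

definition C1 :: "('a::real_normed_vector \<Rightarrow> 'b::real_normed_vector) \<Rightarrow> bool" where
  "C1 f \<longleftrightarrow> (\<exists>f' :: 'a \<Rightarrow> 'a \<Rightarrow>\<^sub>L 'b.
     (\<forall>x. (f has_derivative blinfun_apply (f' x)) (at x)) \<and> continuous_on UNIV f')"

definition cart_prod :: "('n::finite \<Rightarrow> real set) \<Rightarrow> (real^'n) set" where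
  "cart_prod X = {x. \<forall>i. x $ i \<in> X i}"

end

theory Submission
  imports Defs
begin

text \<open>
The idea is to locate a point of the product of the Cantor sets on a given level set of \<open>f\<close>
  by nested boxes whose sides are bridges. Let \<open>y\<close> be a value of \<open>f\<close> on the product of the first
  stages, so that \<open>f a \<le> y \<le> f b\<close> for the lowest and highest corners \<open>a\<close>, \<open>b\<close> of some box of
  first-step bridges. Write \<open>l\<^sub>j = (b\<^sub>j - a\<^sub>j) / (B\<^sub>j - A\<^sub>j)\<close> for the relative sides of a box and
  call the box balanced if \<open>s_min l\<^sub>i \<le> l\<^sub>j\<close> for all \<open>i\<close> and \<open>j\<close>.

  Split the relatively longest side, in direction \<open>i\<close> say, into its child bridges. Passing from one
  child to the next means jumping over a gap of length at most \<open>\<kappa> l\<^sub>i (B\<^sub>i - A\<^sub>i)\<close>. Move from the lowest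
  corner of the box over the right child to the highest corner of the box over the left child:
  this loses the gap in direction \<open>i\<close>, but gains the whole side
  \<open>l\<^sub>j (B\<^sub>j - A\<^sub>j) \<ge> s_min l\<^sub>i (B\<^sub>j - A\<^sub>j)\<close> in each other direction. The hypothesis on the partial
  derivatives says exactly that \<open>f\<close> does not decrease along this segment (\<open>across_gap\<close>). Hence
  the value intervals of consecutive child boxes leave no hole, and one child box still satisfies
  \<open>f a \<le> y \<le> f b\<close>; because the longest side was the one that shrank, and by at most the factor
  \<open>s_min\<close>, that child box is balanced again (\<open>refine_longest_side\<close>).

  Bridges need not shrink to points in an arbitrary Cantor set, but here \<open>s_min\<close> is positive, and
  since every bridge has at least two children, each child has length at most \<open>1 - s_min\<close> times
  that of its father. So after many splittings one side is short, by balance all are, and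
  therefore all levels are high (\<open>boxes_with_high_levels\<close>). Thus \<open>y\<close> is attained on the product of the
  \<open>n\<close>-th stages for each \<open>n\<close>, and by compactness on the product of the Cantor sets.
\<close>

section \<open>Splitting an interval\<close>

lemma splits_subset: "splits I Us Js \<Longrightarrow> J \<in> Js \<Longrightarrow> J \<subseteq> I"
  unfolding splits_def by (metis Diff_subset Union_upper order_trans)

lemma splits_card_ge_2: "splits I Us Js \<Longrightarrow> 2 \<le> card Js"
  using card_gt_0_iff[of Us] by (simp add: splits_def)

lemma splits_closed_interval:
  assumes "splits I Us Js" "J \<in> Js"
  obtains l r where "l < r" "J = {l..r}"
proof -
  have "closed_interval J" using assms by (simp add: splits_def)
  then show ?thesis using that by (auto simp: closed_interval_def)
qed

lemma splits_gap:
  assumes "splits I Us Js" "U \<in> Us"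
  obtains p q where "p < q" "U = {p<..<q}" "U \<subseteq> I"
proof -
  have "open_interval U" "U \<subseteq> I" using assms by (simp_all add: splits_def)
  then show ?thesis using that by (auto simp: open_interval_def)
qed

lemma splits_disjnt: "splits I Us Js \<Longrightarrow> J \<in> Js \<Longrightarrow> J' \<in> Js \<Longrightarrow> x \<in> J \<Longrightarrow> x \<in> J' \<Longrightarrow> J = J'"
  unfolding splits_def by (meson disjnt_iff pairwiseD)

lemma splits_endpoints:
  assumes "splits {a..b} Us Js" "a \<le> b"
  shows "a \<in> \<Union>Js" "b \<in> \<Union>Js"
proof -
  have Un: "\<Union>Js = {a..b} - \<Union>Us" using assms(1) by (simp add: splits_def)
  have "a \<notin> U \<and> b \<notin> U" if "U \<in> Us" for U
  proof -
    obtain p q where "p < q" "U = {p<..<q}" "U \<subseteq> {a..b}"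
      using splits_gap[OF assms(1) \<open>U \<in> Us\<close>] .
    then show ?thesis by (auto simp: greaterThanLessThan_subseteq_atLeastAtMost_iff)
  qed
  then show "a \<in> \<Union>Js" "b \<in> \<Union>Js" unfolding Un using assms(2) by auto
qed

text \<open>
The definition of a splitting does not order the child bridges. Taking for \<open>v\<close> the least left
  endpoint beyond \<open>r\<close>, nothing between \<open>r\<close> and \<open>v\<close> can belong to a bridge, so \<open>r\<close> and \<open>v\<close> are the two ends
  of one and the same gap.
\<close>

lemma splits_next:
  assumes sp: "splits {a..b} Us Js" and J: "{l..r} \<in> Js" and lr: "l < r" and rb: "r \<noteq> b"
  obtains v w where "{r<..<v} \<in> Us" "r < v" "v < w" "{v..w} \<in> Js"
proof -
  have Un: "\<Union>Js = {a..b} - \<Union>Us" and fin: "finite Js" and dis: "disjoint Us"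
    using sp by (simp_all add: splits_def)
  have "r \<in> {a..b}" using splits_subset[OF sp J] lr by auto
  with rb have ab: "a \<le> b" "a \<le> r" "r < b" by auto
  define V where "V = {v. r < v \<and> (\<exists>w>v. {v..w} \<in> Js)}"
  have "V \<subseteq> Inf ` Js"
  proof
    fix v assume "v \<in> V"
    then obtain w where "v < w" "{v..w} \<in> Js" by (auto simp: V_def)
    then show "v \<in> Inf ` Js" by (metis cInf_atLeastAtMost image_eqI less_imp_le)
  qed
  then have finV: "finite V" using fin finite_surj by blast
  have "V \<noteq> {}"
  proof -
    obtain J' where J': "J' \<in> Js" "b \<in> J'" using splits_endpoints(2)[OF sp ab(1)] by blast
    then obtain v w where vw: "v < w" "J' = {v..w}" using splits_closed_interval[OF sp] by blast
    have "r < v"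
    proof (rule ccontr)
      assume "\<not> r < v"
      then have "r \<in> J'" using vw J' ab by auto
      then have "J' = {l..r}" using splits_disjnt[OF sp J'(1) J] lr by auto
      then show False using J'(2) ab by auto
    qed
    then show ?thesis using vw J' unfolding V_def by blast
  qed
  define v where "v = Min V"
  have "v \<in> V" using finV \<open>V \<noteq> {}\<close> unfolding v_def by simp
  then obtain w where w: "r < v" "v < w" "{v..w} \<in> Js" by (auto simp: V_def)
  have vb: "v \<in> {a..b}" using splits_subset[OF sp w(3)] w by auto
  have "t \<notin> \<Union>Js" if t: "r < t" "t < v" for t
  proof
    assume "t \<in> \<Union>Js"
    then obtain J' where J': "J' \<in> Js" "t \<in> J'" by blast
    then obtain v' w' where vw: "v' < w'" "J' = {v'..w'}" using splits_closed_interval[OF sp] by blast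
    have "v' \<le> r"
    proof (rule ccontr)
      assume "\<not> v' \<le> r"
      then have "v' \<in> V" using vw J'(1) by (auto simp: V_def)
      then have "v \<le> v'" unfolding v_def using finV by simp
      then show False using t J' vw by auto
    qed
    then have "r \<in> J'" using vw J' t by auto
    then have "J' = {l..r}" using splits_disjnt[OF sp J'(1) J] lr by auto
    then show False using J'(2) t by auto
  qed
  then have sub: "{r<..<v} \<subseteq> \<Union>Us" using Un vb ab by fastforce
  \<comment> \<open>a connected set covered by disjoint open sets lies in one of them\<close>
  obtain U where U: "U \<in> Us" "{r<..<v} \<subseteq> U"
  proof -
    obtain t where t: "r < t" "t < v" using dense w(1) by blast
    then obtain U where U: "U \<in> Us" "t \<in> U" using sub by auto
    have op: "open U'" if "U' \<in> Us" for U'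
      using splits_gap[OF sp that] open_greaterThanLessThan by metis
    have "connected {r<..<v}" by simp
    moreover have "open (\<Union>(Us - {U}))" using op by blast
    moreover have "U \<inter> \<Union>(Us - {U}) \<inter> {r<..<v} = {}"
      using dis U(1) by (auto simp: pairwise_def disjnt_iff)
    moreover have "{r<..<v} \<subseteq> U \<union> \<Union>(Us - {U})" using sub by auto
    ultimately have "U \<inter> {r<..<v} = {} \<or> \<Union>(Us - {U}) \<inter> {r<..<v} = {}"
      using connectedD op[OF U(1)] by metis
    then have "{r<..<v} \<subseteq> U" using t U sub by auto
    then show ?thesis using that U by blast
  qed
  obtain p q where pq: "p < q" "U = {p<..<q}" using splits_gap[OF sp U(1)] .
  have "r \<in> \<Union>Js" by (rule UnionI[OF J]) (use lr in simp)
  moreover have "v \<in> \<Union>Js" by (rule UnionI[OF w(3)]) (use w in simp)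
  ultimately have "r \<notin> U" "v \<notin> U" using Un U(1) by auto
  moreover have "p \<le> r" "v \<le> q" using U(2) w(1) unfolding pq(2) greaterThanLessThan_subseteq_greaterThanLessThan by auto
  ultimately have "U = {r<..<v}" using w(1) pq by auto
  then show ?thesis using that U(1) w by blast
qed

text \<open>
A bridge shares its father with at least one sibling, which takes up length \<open>c\<close>.
\<close>

lemma splits_bridge_len:
  assumes sp: "splits {a..b} Us Js" and J: "J \<in> Js" and s: "\<And>J'. J' \<in> Js \<Longrightarrow> c \<le> len J'"
  shows "len J \<le> len {a..b} - c"
proof -
  obtain J' where J': "J' \<in> Js" "J' \<noteq> J"
  proof -
    have "\<not> Js \<subseteq> {J}" using splits_card_ge_2[OF sp] card_mono[of "{J}" Js] by auto
    then show ?thesis using that by blast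
  qed
  obtain l r where lr: "l < r" "J = {l..r}" using splits_closed_interval[OF sp J] .
  obtain l' r' where lr': "l' < r'" "J' = {l'..r'}" using splits_closed_interval[OF sp J'(1)] .
  have sub: "J \<subseteq> {a..b}" "J' \<subseteq> {a..b}" using splits_subset[OF sp] J J' by auto
  have "J \<inter> J' = {}" using splits_disjnt[OF sp J J'(1)] J'(2) by blast
  then have "r < l' \<or> r' < l" using lr lr' by (auto simp: disjoint_iff)
  moreover have "a \<le> l" "r \<le> b" "a \<le> l'" "r' \<le> b" using sub lr lr' by auto
  ultimately show ?thesis using s[OF J'(1)] lr lr' by auto
qed

text \<open>
Here \<open>g l\<close> and \<open>h r\<close> stand for the least and the greatest value of \<open>f\<close> on the box over the child
  bridge \<open>{l..r}\<close>. Take the last child whose least value does not exceed \<open>y\<close>: if it is not the last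
  child of all, the least value of its successor exceeds \<open>y\<close>, and across the gap between the two
  it is bounded by the greatest value of the chosen child.
\<close>

lemma splits_select_bridge:
  fixes g h :: "real \<Rightarrow> real"
  assumes sp: "splits {a..b} Us Js" and ab: "a \<le> b"
    and "g a \<le> y" "y \<le> h b"
    and gap: "\<And>r v. {r<..<v} \<in> Us \<Longrightarrow> r < v \<Longrightarrow> g v \<le> h r"
  obtains l r where "{l..r} \<in> Js" "l < r" "g l \<le> y" "y \<le> h r"
proof -
  define L where "L = {l. g l \<le> y \<and> (\<exists>r>l. {l..r} \<in> Js)}"
  have "L \<subseteq> Inf ` Js"
  proof
    fix v assume "v \<in> L"
    then obtain w where "v < w" "{v..w} \<in> Js" by (auto simp: L_def)
    then show "v \<in> Inf ` Js" by (metis cInf_atLeastAtMost image_eqI less_imp_le)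
  qed
  moreover have "finite Js" using sp by (simp add: splits_def)
  ultimately have finL: "finite L" using finite_surj by blast
  obtain J where J: "J \<in> Js" "a \<in> J" using splits_endpoints(1)[OF sp ab] by blast
  obtain l0 r0 where "l0 < r0" "J = {l0..r0}" using splits_closed_interval[OF sp J(1)] .
  moreover from this have "l0 = a" using J splits_subset[OF sp J(1)] by auto
  ultimately have "a \<in> L" using J assms by (auto simp: L_def)
  then have "Max L \<in> L" using finL Max_in by blast
  then obtain r where r: "g (Max L) \<le> y" "Max L < r" "{Max L..r} \<in> Js" by (auto simp: L_def)
  have "y \<le> h r"
  proof (cases "r = b")
    case False
    obtain v w where vw: "{r<..<v} \<in> Us" "r < v" "v < w" "{v..w} \<in> Js"
      using splits_next[OF sp r(3,2) False] .
    have "v \<notin> L" using Max_ge[OF finL, of v] r(2) vw(2) by fastforce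
    then have "y < g v" using vw by (auto simp: L_def)
    then show ?thesis using gap[OF vw(1,2)] by simp
  qed (use assms in simp)
  then show ?thesis using that r by blast
qed

section \<open>The stages of a Cantor construction\<close>

lemma construction_split:
  assumes "cantor_construction A B F G" "I \<in> F k"
  obtains Us Js where "splits I Us Js" "Js \<subseteq> F (Suc k)" "Us \<subseteq> G (Suc k)"
proof -
  obtain Us Js where *: "\<forall>I\<in>F k. splits I (Us I) (Js I)"
        "F (Suc k) = (\<Union>I\<in>F k. Js I)" "G (Suc k) = (\<Union>I\<in>F k. Us I)"
    using assms(1) unfolding cantor_construction_def by meson
  show ?thesis by (rule that[of "Us I" "Js I"]) (use * assms(2) in auto)
qed

lemma construction_bridge_in_split:
  assumes "cantor_construction A B F G" "J \<in> F (Suc k)"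
  obtains I Us Js where "I \<in> F k" "splits I Us Js" "J \<in> Js" "Js \<subseteq> F (Suc k)"
proof -
  obtain Us Js where *: "\<forall>I\<in>F k. splits I (Us I) (Js I)"
        "F (Suc k) = (\<Union>I\<in>F k. Js I)" "G (Suc k) = (\<Union>I\<in>F k. Us I)"
    using assms(1) unfolding cantor_construction_def by meson
  then obtain I where "I \<in> F k" "J \<in> Js I" using assms(2) by auto
  then show ?thesis using that[of I "Us I" "Js I"] * by auto
qed

lemma construction_gap_in_split:
  assumes "cantor_construction A B F G" "U \<in> G (Suc k)"
  obtains I Us Js where "I \<in> F k" "splits I Us Js" "U \<in> Us"
proof -
  obtain Us Js where *: "\<forall>I\<in>F k. splits I (Us I) (Js I)"
        "F (Suc k) = (\<Union>I\<in>F k. Js I)" "G (Suc k) = (\<Union>I\<in>F k. Us I)"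
    using assms(1) unfolding cantor_construction_def by meson
  then obtain I where "I \<in> F k" "U \<in> Us I" using assms(2) by auto
  then show ?thesis using that[of I "Us I" "Js I"] * by auto
qed

lemma construction_stage:
  assumes C: "cantor_construction A B F G"
  shows "finite (F k) \<and> (\<forall>I\<in>F k. closed_interval I) \<and> disjoint (F k) \<and> F k \<noteq> {}"
proof (induction k)
  case 0
  then show ?case using C by (auto simp: cantor_construction_def closed_interval_def)
next
  case (Suc k)
  obtain Us Js where *: "\<forall>I\<in>F k. splits I (Us I) (Js I)" "F (Suc k) = (\<Union>I\<in>F k. Js I)"
    using C unfolding cantor_construction_def by meson
  have "finite (F (Suc k))" "\<forall>I\<in>F (Suc k). closed_interval I"
    using Suc * by (auto simp: splits_def)
  moreover have "disjoint (F (Suc k))"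
  proof (rule pairwiseI)
    fix J J' assume "J \<in> F (Suc k)" "J' \<in> F (Suc k)" and ne: "J \<noteq> J'"
    then obtain I I' where I: "I \<in> F k" "J \<in> Js I" "I' \<in> F k" "J' \<in> Js I'" using *(2) by auto
    show "disjnt J J'"
    proof (cases "I = I'")
      case True
      then show ?thesis using *(1) I ne by (auto simp: splits_def pairwise_def)
    next
      case False
      then have "disjnt I I'" using Suc I by (auto simp: pairwise_def)
      moreover have "J \<subseteq> I" "J' \<subseteq> I'" using I * splits_subset by blast+
      ultimately show ?thesis by (auto simp: disjnt_iff)
    qed
  qed
  moreover have "F (Suc k) \<noteq> {}"
  proof -
    obtain I where I: "I \<in> F k" using Suc by auto
    then have "Js I \<noteq> {}" using * splits_card_ge_2[of I "Us I" "Js I"] by auto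
    then show ?thesis using I * by auto
  qed
  ultimately show ?case by blast
qed

lemma construction_interval:
  assumes "cantor_construction A B F G" "I \<in> F k"
  obtains a b where "a < b" "I = {a..b}"
  using construction_stage[OF assms(1), of k] assms(2) unfolding closed_interval_def by blast

lemma construction_antimono:
  assumes C: "cantor_construction A B F G" and "k \<le> n"
  shows "\<Union>(F n) \<subseteq> \<Union>(F k)"
  using \<open>k \<le> n\<close>
proof (rule lift_Suc_antimono_le[rotated])
  fix n show "\<Union>(F (Suc n)) \<subseteq> \<Union>(F n)"
  proof (rule Union_least)
    fix J assume "J \<in> F (Suc n)"
    then obtain I Us Js where "I \<in> F n" "splits I Us Js" "J \<in> Js"
      using construction_bridge_in_split[OF C] by metis
    then show "J \<subseteq> \<Union>(F n)" using splits_subset by blast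
  qed
qed

lemma construction_subset:
  assumes C: "cantor_construction A B F G" and "I \<in> F k"
  shows "I \<subseteq> {A..B}"
  using construction_antimono[OF C, of 0 k] assms by (auto simp: cantor_construction_def)

lemma father_eq:
  assumes C: "cantor_construction A B F G" and "I \<in> F k" "X \<subseteq> I" "X \<noteq> {}"
  shows "father F (Suc k) X = I"
  unfolding father_def
proof (rule the_equality)
  fix J assume J: "J \<in> F (Suc k - 1) \<and> X \<subseteq> J"
  have "disjoint (F k)" using construction_stage[OF C] by blast
  moreover have "\<not> disjnt J I" using J assms by (auto simp: disjnt_iff)
  ultimately show "J = I" using J assms by (auto simp: pairwise_def)
qed (use assms in simp)

section \<open>The extremal ratios\<close>

lemma s_min_le:
  fixes F :: "'n::finite \<Rightarrow> nat \<Rightarrow> real set set"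
  assumes C: "\<And>i. cantor_construction (A i) (B i) (F i) (G i)"
    and I: "I \<in> F i k" and J: "J \<in> F i (Suc k)" "J \<subseteq> I"
  shows "s_min F * len I \<le> len J"
proof -
  let ?R = "\<lambda>i. {len I / len (father (F i) k I) | k I. k \<ge> 1 \<and> I \<in> F i k}"
  obtain a b where ab: "a < b" "I = {a..b}" using construction_interval[OF C I] .
  obtain l r where lr: "l < r" "J = {l..r}" using construction_interval[OF C J(1)] .
  have "J \<noteq> {}" using lr by auto
  have "s_min F \<le> Inf (?R i)" unfolding s_min_def by (rule Min_le) auto
  also have "\<dots> \<le> len J / len (father (F i) (Suc k) J)"
  proof (rule cInf_lower)
    show "len J / len (father (F i) (Suc k) J) \<in> ?R i" using J by force
    show "bdd_below (?R i)" by (rule bdd_belowI[of _ 0]) auto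
  qed
  also have "father (F i) (Suc k) J = I" using father_eq[OF C I J(2) \<open>J \<noteq> {}\<close>] .
  finally show ?thesis using ab by (simp add: field_simps)
qed

lemma s_min_nonneg:
  fixes F :: "'n::finite \<Rightarrow> nat \<Rightarrow> real set set"
  assumes C: "\<And>i. cantor_construction (A i) (B i) (F i) (G i)"
  shows "0 \<le> s_min F"
proof -
  have "0 \<le> Inf {len I / len (father (F i) k I) | k I. k \<ge> 1 \<and> I \<in> F i k}" for i
  proof (rule cInf_greatest)
    obtain I where "I \<in> F i 1" using construction_stage[OF C[of i], of 1] by blast
    then show "{len I / len (father (F i) k I) | k I. k \<ge> 1 \<and> I \<in> F i k} \<noteq> {}" by blast
  qed auto
  then show ?thesis unfolding s_min_def by (subst Min_ge_iff) auto
qed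

text \<open>
The supremum is meaningful because a gap is no longer than its father, so the ratios are bounded
  by 1.
\<close>

lemma kappa_ge:
  fixes F G :: "'n::finite \<Rightarrow> nat \<Rightarrow> real set set"
  assumes C: "\<And>i. cantor_construction (A i) (B i) (F i) (G i)"
    and I: "I \<in> F i k" and k: "1 \<le> k" and U: "U \<in> G i (Suc k)" "U \<subseteq> I" "open_interval U"
  shows "len U \<le> kappa F G * len I"
proof -
  let ?R = "\<lambda>i. {len U / len (father (F i) k U) | k U. k \<ge> 1 \<and> U \<in> G i k \<and> U \<subseteq> \<Union>(F i 1)}"
  obtain a b where ab: "a < b" "I = {a..b}" using construction_interval[OF C I] .
  have "U \<noteq> {}" using U(3) by (auto simp: open_interval_def)
  have sub: "U \<subseteq> \<Union>(F i 1)" using construction_antimono[OF C k, of i] I U(2) by blast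
  have "len U / len I = len U / len (father (F i) (Suc k) U)"
    using father_eq[OF C I U(2) \<open>U \<noteq> {}\<close>] by simp
  also have "\<dots> \<le> Sup (?R i)"
  proof (rule cSup_upper)
    show "len U / len (father (F i) (Suc k) U) \<in> ?R i" using U sub by force
    have "len U' / len (father (F i) n U') \<le> 1" if n: "n \<ge> 1" "U' \<in> G i n" for n U'
    proof -
      obtain m where m: "n = Suc m" using n by (cases n) auto
      obtain I' Us Js where I': "I' \<in> F i m" "splits I' Us Js" "U' \<in> Us"
        using construction_gap_in_split[OF C n(2)[unfolded m]] .
      obtain p q where pq: "p < q" "U' = {p<..<q}" "U' \<subseteq> I'"
        using splits_gap[OF I'(2,3)] .
      obtain c d where cd: "c < d" "I' = {c..d}" using construction_interval[OF C I'(1)] .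
      have "father (F i) n U' = I'" unfolding m using father_eq[OF C I'(1) pq(3)] pq by auto
      moreover have "c \<le> p" "q \<le> d"
        using pq cd by (auto simp: greaterThanLessThan_subseteq_atLeastAtMost_iff)
      ultimately show ?thesis using pq cd by simp
    qed
    then show "bdd_above (?R i)" by (intro bdd_aboveI[of _ 1]) auto
  qed
  also have "\<dots> \<le> kappa F G" unfolding kappa_def by (rule Max_ge) auto
  finally show ?thesis using ab by (simp add: field_simps)
qed

text \<open>
A gap of the second step lies in the first stage, so it is counted in \<open>kappa\<close>.
\<close>

lemma kappa_pos:
  fixes F G :: "'n::finite \<Rightarrow> nat \<Rightarrow> real set set"
  assumes C: "\<And>i. cantor_construction (A i) (B i) (F i) (G i)"
  shows "0 < kappa F G"
proof -
  fix i :: 'n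
  obtain I where I: "I \<in> F i 1" using construction_stage[OF C[of i], of 1] by blast
  obtain Us Js where UJ: "splits I Us Js" "Us \<subseteq> G i (Suc 1)"
    using construction_split[OF C I] by metis
  obtain a b where ab: "a < b" "I = {a..b}" using construction_interval[OF C I] .
  have "Us \<noteq> {}" using UJ by (simp add: splits_def)
  then obtain U where U: "U \<in> Us" by blast
  then have U': "open_interval U" "U \<subseteq> I" using UJ by (simp_all add: splits_def)
  then have "0 < len U" by (auto simp: open_interval_def)
  also have "\<dots> \<le> kappa F G * len I" 
    using kappa_ge[where F = F and G = G and i = i and k = 1, OF C I le_refl _ U'(2,1)] U UJ by auto
  finally show ?thesis using ab by (simp add: zero_less_mult_iff)
qed

section \<open>Monotonicity along segments, and products of compact sets\<close>

lemma C1_deriv_along_line: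
  fixes f :: "real^'n::finite \<Rightarrow> real"
  assumes "C1 f"
  shows "((\<lambda>t. f (p + t *\<^sub>R v)) has_real_derivative (\<Sum>j\<in>UNIV. v $ j * partial j f (p + t *\<^sub>R v))) (at t)"
proof -
  obtain f' :: "real^'n \<Rightarrow> (real^'n) \<Rightarrow>\<^sub>L real"
    where f': "\<And>x. (f has_derivative blinfun_apply (f' x)) (at x)"
    using assms unfolding C1_def by blast
  have line: "((\<lambda>t. f (q + t *\<^sub>R w)) has_real_derivative f' (q + t *\<^sub>R w) w) (at t)" for q w t
  proof -
    have "((\<lambda>t. f (q + t *\<^sub>R w)) has_derivative (\<lambda>h. f' (q + t *\<^sub>R w) (h *\<^sub>R w))) (at t)"
      by (rule has_derivative_compose[OF _ f']) (auto intro!: derivative_eq_intros)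
    then show ?thesis
      unfolding has_field_derivative_def by (simp add: blinfun.scaleR_right mult.commute[of _ "blinfun_apply _ _"])
  qed
  have "partial j f x = f' x (axis j 1)" for j x
    unfolding partial_def using line[of x "axis j 1" 0] DERIV_imp_deriv by fastforce
  moreover have "f' x v = (\<Sum>j\<in>UNIV. v $ j * f' x (axis j 1))" for x
  proof -
    have "f' x v = f' x (\<Sum>j\<in>UNIV. v $ j *\<^sub>R axis j 1)"
      using basis_expansion[of v] by (simp add: scalar_mult_eq_scaleR)
    then show ?thesis by (simp add: blinfun.sum_right blinfun.scaleR_right)
  qed
  ultimately show ?thesis using line[of p v t] by simp
qed

lemma C1_le_along_segment:
  fixes f :: "real^'n::finite \<Rightarrow> real"
  assumes "C1 f"
    and "\<And>t. 0 \<le> t \<Longrightarrow> t \<le> 1 \<Longrightarrow> 0 \<le> (\<Sum>j\<in>UNIV. (q $ j - p $ j) * partial j f (p + t *\<^sub>R (q - p)))"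
  shows "f p \<le> f q"
  using DERIV_nonneg_imp_nondecreasing[of 0 1 "\<lambda>t. f (p + t *\<^sub>R (q - p))"]
    C1_deriv_along_line[OF assms(1), of p "q - p"] assms(2) by fastforce

lemma C1_less_along_segment:
  fixes f :: "real^'n::finite \<Rightarrow> real"
  assumes "C1 f"
    and "\<And>t. 0 \<le> t \<Longrightarrow> t \<le> 1 \<Longrightarrow> 0 < (\<Sum>j\<in>UNIV. (q $ j - p $ j) * partial j f (p + t *\<^sub>R (q - p)))"
  shows "f p < f q"
  using DERIV_pos_imp_increasing[of 0 1 "\<lambda>t. f (p + t *\<^sub>R (q - p))"]
    C1_deriv_along_line[OF assms(1), of p "q - p"] assms(2) by fastforce

lemma segment_in_cart_prod:
  fixes p q :: "real^'n::finite"
  assumes "p \<in> cart_prod (\<lambda>j. {a j..b j})" "q \<in> cart_prod (\<lambda>j. {a j..b j})" "0 \<le> t" "t \<le> 1"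
  shows "p + t *\<^sub>R (q - p) \<in> cart_prod (\<lambda>j. {a j..b j})"
proof -
  have "(1 - t) * p $ j + t * q $ j \<in> {a j..b j}" for j
    using convexD_alt[OF convex_real_interval(5), of "p $ j" "a j" "b j" "q $ j" t] assms
    by (auto simp: cart_prod_def)
  then show ?thesis by (simp add: cart_prod_def algebra_simps)
qed

lemma compact_cart_prod:
  fixes X :: "'n::finite \<Rightarrow> real set"
  assumes "\<And>i. compact (X i)"
  shows "compact (cart_prod X :: (real^'n) set)"
  unfolding compact_eq_bounded_closed
proof
  have "cart_prod X = (\<Inter>i. (\<lambda>x. x $ i) -` X i)" by (auto simp: cart_prod_def)
  moreover have "closed ((\<lambda>x::real^'n. x $ i) -` X i)" for i
    using compact_imp_closed[OF assms] by (intro closed_vimage continuous_intros)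
  ultimately show "closed (cart_prod X)" by (simp add: closed_INT)
  have "\<exists>c. \<forall>x\<in>X i. \<bar>x\<bar> \<le> c" for i
    using compact_imp_bounded[OF assms[of i]] by (auto simp: bounded_iff)
  then obtain c where c: "\<And>i x. x \<in> X i \<Longrightarrow> \<bar>x\<bar> \<le> c i" by metis
  show "bounded (cart_prod X)"
  proof (rule bounded_subset[OF bounded_cbox])
    show "cart_prod X \<subseteq> cbox (\<chi> i. - c i) (\<chi> i. c i)"
    proof
      fix x assume "x \<in> cart_prod X"
      then have "\<bar>x $ i\<bar> \<le> c i" for i using c by (simp add: cart_prod_def)
      then have "- c i \<le> x $ i \<and> x $ i \<le> c i" for i by (simp add: abs_le_iff minus_le_iff)
      then show "x \<in> cbox (\<chi> i. - c i) (\<chi> i. c i)" by (simp add: mem_box_cart)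
    qed
  qed
qed

section \<open>Boxes of bridges\<close>

text \<open>
The constants \<open>s\<close> and \<open>\<kappa>\<close> abstract from the extremal ratios: only the resulting bounds on the
  lengths of bridges and gaps enter the argument. Gaps of the first step are not counted in \<open>kappa\<close>,
  so the bound on gaps is available only inside fathers of level at least 1; accordingly the boxes
  below are never larger than a box of first-step bridges.
\<close>

locale gap_dominated =
  fixes f :: "real^'n::finite \<Rightarrow> real"
    and A B :: "'n \<Rightarrow> real"
    and F G :: "'n \<Rightarrow> nat \<Rightarrow> real set set"
    and s \<kappa> :: real
  assumes C1: "C1 f"
    and construction: "\<And>i. cantor_construction (A i) (B i) (F i) (G i)"
    and partial_pos: "\<And>i x. x \<in> cart_prod (\<lambda>j. {A j..B j}) \<Longrightarrow> partial i f x > 0"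
    and domination: "\<And>i x. x \<in> cart_prod (\<lambda>j. {A j..B j}) \<Longrightarrow>
           \<kappa> * (B i - A i) * partial i f x \<le> s * (\<Sum>j\<in>UNIV - {i}. (B j - A j) * partial j f x)"
    and s_pos: "0 < s"
    and bridge_ratio: "\<And>i k I J. I \<in> F i k \<Longrightarrow> J \<in> F i (Suc k) \<Longrightarrow> J \<subseteq> I \<Longrightarrow> s * len I \<le> len J"
    and gap_ratio: "\<And>i k I U. I \<in> F i k \<Longrightarrow> 1 \<le> k \<Longrightarrow> U \<in> G i (Suc k) \<Longrightarrow> U \<subseteq> I \<Longrightarrow>
           open_interval U \<Longrightarrow> len U \<le> \<kappa> * len I"
begin

lemma AB: "A i < B i"
  using construction[of i] by (simp add: cantor_construction_def)

lemma f_mono: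
  assumes "p \<in> cart_prod (\<lambda>j. {A j..B j})" "q \<in> cart_prod (\<lambda>j. {A j..B j})"
    and "\<And>j. p $ j \<le> q $ j"
  shows "f p \<le> f q"
proof (rule C1_le_along_segment[OF C1])
  fix t :: real assume "0 \<le> t" "t \<le> 1"
  then have "p + t *\<^sub>R (q - p) \<in> cart_prod (\<lambda>j. {A j..B j})"
    using assms segment_in_cart_prod by blast
  then show "0 \<le> (\<Sum>j\<in>UNIV. (q $ j - p $ j) * partial j f (p + t *\<^sub>R (q - p)))"
    using assms(3) partial_pos by (intro sum_nonneg mult_nonneg_nonneg) (auto intro: less_imp_le)
qed

lemma f_strict_mono:
  assumes "p \<in> cart_prod (\<lambda>j. {A j..B j})" "q \<in> cart_prod (\<lambda>j. {A j..B j})"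
    and "\<And>j. p $ j < q $ j"
  shows "f p < f q"
proof (rule C1_less_along_segment[OF C1])
  fix t :: real assume "0 \<le> t" "t \<le> 1"
  then have "p + t *\<^sub>R (q - p) \<in> cart_prod (\<lambda>j. {A j..B j})"
    using assms segment_in_cart_prod by blast
  then show "0 < (\<Sum>j\<in>UNIV. (q $ j - p $ j) * partial j f (p + t *\<^sub>R (q - p)))"
    using assms(3) partial_pos by (intro sum_pos mult_pos_pos) auto
qed

lemma continuous_f: "continuous_on S f"
  using C1 unfolding C1_def
  by (meson continuous_at_imp_continuous_on has_derivative_continuous)

text \<open>
The levels \<open>k i\<close> may differ from one direction to another, since only one side at a time is split.
\<close>

definition bridge_box :: "('n \<Rightarrow> nat) \<Rightarrow> real^'n \<Rightarrow> real^'n \<Rightarrow> bool" where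
  "bridge_box k a b \<longleftrightarrow> (\<forall>i. 1 \<le> k i \<and> a $ i < b $ i \<and> {a $ i..b $ i} \<in> F i (k i))"

lemma bridge_box_subset:
  assumes "bridge_box k a b"
  shows "cart_prod (\<lambda>i. {a $ i..b $ i}) \<subseteq> cart_prod (\<lambda>i. {A i..B i})"
  using assms construction_subset[OF construction] unfolding bridge_box_def cart_prod_def by blast

lemma bridge_box_corners:
  assumes "bridge_box k a b"
  shows "a \<in> cart_prod (\<lambda>i. {A i..B i})" "b \<in> cart_prod (\<lambda>i. {A i..B i})"
proof -
  have "a \<in> cart_prod (\<lambda>i. {a $ i..b $ i})" "b \<in> cart_prod (\<lambda>i. {a $ i..b $ i})"
    using assms by (auto simp: bridge_box_def cart_prod_def less_imp_le)
  then show "a \<in> cart_prod (\<lambda>i. {A i..B i})" "b \<in> cart_prod (\<lambda>i. {A i..B i})"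
    using bridge_box_subset[OF assms] by blast+
qed

text \<open>
Monotonicity in each variable makes the corners extremal, and connectedness of the box fills in
  the values between.
\<close>

lemma image_bridge_box:
  assumes "bridge_box k a b"
  shows "f ` cart_prod (\<lambda>i. {a $ i..b $ i}) = {f a..f b}"
proof -
  let ?Q = "cart_prod (\<lambda>i. {a $ i..b $ i})"
  have ab: "a $ i \<le> b $ i" for i using assms by (auto simp: bridge_box_def less_imp_le)
  have Q: "?Q = cbox a b" by (auto simp: cart_prod_def mem_box_cart)
  have "connected (f ` ?Q)" unfolding Q
    by (intro connected_continuous_image continuous_f convex_connected convex_box)
  moreover have "a \<in> ?Q" "b \<in> ?Q" using ab by (auto simp: cart_prod_def)
  ultimately have "{f a..f b} \<subseteq> f ` ?Q" using connected_contains_Icc by blast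
  moreover have "f ` ?Q \<subseteq> {f a..f b}"
  proof
    fix y assume "y \<in> f ` ?Q"
    then obtain x where x: "x \<in> ?Q" "y = f x" by blast
    then have "x \<in> cart_prod (\<lambda>i. {A i..B i})" using bridge_box_subset[OF assms] by blast
    moreover have "a $ i \<le> x $ i" "x $ i \<le> b $ i" for i using x by (auto simp: cart_prod_def)
    ultimately show "y \<in> {f a..f b}" using x f_mono bridge_box_corners[OF assms] by simp
  qed
  ultimately show ?thesis by blast
qed

text \<open>
Sides are measured relative to the hulls \<open>{A i..B i}\<close>, which turns the weights \<open>B i - A i\<close> of the
  hypothesis into the uniform comparison of sides below.
\<close>

definition side :: "real^'n \<Rightarrow> real^'n \<Rightarrow> 'n \<Rightarrow> real" where
  "side a b i = (b $ i - a $ i) / (B i - A i)"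

lemma side_eq: "b $ i - a $ i = side a b i * (B i - A i)"
  using AB[of i] by (simp add: side_def)

definition balanced :: "real^'n \<Rightarrow> real^'n \<Rightarrow> bool" where
  "balanced a b \<longleftrightarrow> (\<forall>i j. s * side a b i \<le> side a b j)"

section \<open>Refining a box\<close>

lemma bridge_side_lower:
  assumes "{l..r} \<in> F i k" "l < r"
  shows "s ^ k * (B i - A i) \<le> r - l"
  using assms
proof (induction k arbitrary: l r)
  case 0
  then show ?case using construction[of i] by (auto simp: cantor_construction_def Icc_eq_Icc)
next
  case (Suc k)
  obtain I Us Js where I: "I \<in> F i k" "splits I Us Js" "{l..r} \<in> Js"
    using construction_bridge_in_split[OF construction Suc.prems(1)] by metis
  obtain l' r' where lr: "l' < r'" "I = {l'..r'}" using construction_interval[OF construction I(1)] .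
  have "s ^ Suc k * (B i - A i) = s * (s ^ k * (B i - A i))" by simp
  also have "\<dots> \<le> s * (r' - l')" using Suc.IH[of l' r'] I lr s_pos by simp
  also have "\<dots> \<le> r - l"
    using bridge_ratio[OF I(1) Suc.prems(1) splits_subset[OF I(2,3)]] lr Suc.prems by simp
  finally show ?case .
qed

lemma bridge_side_upper:
  assumes "{l..r} \<in> F i k" "l < r"
  shows "r - l \<le> (1 - s) ^ k * (B i - A i)"
  using assms
proof (induction k arbitrary: l r)
  case 0
  then show ?case using construction[of i] by (auto simp: cantor_construction_def Icc_eq_Icc)
next
  case (Suc k)
  obtain I Us Js where I: "I \<in> F i k" "splits I Us Js" "{l..r} \<in> Js" "Js \<subseteq> F i (Suc k)"
    using construction_bridge_in_split[OF construction Suc.prems(1)] .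
  obtain l' r' where lr: "l' < r'" "I = {l'..r'}" using construction_interval[OF construction I(1)] .
  have ratio: "s * len I \<le> len J" if "J \<in> Js" for J
    using bridge_ratio[OF I(1) _ splits_subset[OF I(2) that]] that I(4) by auto
  have "r - l \<le> (r' - l') - s * (r' - l')"
    using splits_bridge_len[OF I(2)[unfolded lr(2)] I(3), of "s * len I"] ratio lr Suc.prems by simp
  also have "\<dots> = (1 - s) * (r' - l')" by (simp add: algebra_simps)
  also have "\<dots> \<le> (1 - s) * ((1 - s) ^ k * (B i - A i))"
  proof (rule mult_left_mono)
    show "r' - l' \<le> (1 - s) ^ k * (B i - A i)" using Suc.IH[of l' r'] I lr by simp
    have "s * (r' - l') \<le> r - l" using ratio[OF I(3)] lr Suc.prems by simp
    also have "\<dots> \<le> r' - l'" using splits_subset[OF I(2,3)] lr Suc.prems by auto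
    finally show "0 \<le> 1 - s" using lr by simp
  qed
  finally show ?case by simp
qed

lemma s_less_1: "s < 1"
proof -
  fix i
  have "{A i..B i} \<in> F i 0" using construction[of i] by (simp add: cantor_construction_def)
  then obtain Us Js where UJ: "splits {A i..B i} Us Js" "Js \<subseteq> F i (Suc 0)"
    using construction_split[OF construction] by metis
  have "Js \<noteq> {}" using splits_card_ge_2[OF UJ(1)] by auto
  then obtain J where J: "J \<in> Js" by blast
  obtain l r where lr: "l < r" "J = {l..r}" using splits_closed_interval[OF UJ(1) J] .
  have "r - l \<le> (1 - s) ^ Suc 0 * (B i - A i)" using J lr UJ(2) by (intro bridge_side_upper) auto
  then have "0 < (1 - s) * (B i - A i)" using lr by simp
  then show ?thesis using AB[of i] by (simp add: zero_less_mult_iff)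
qed

text \<open>
The segment runs from the lowest corner of the box over the bridge beginning at \<open>v\<close> to the
  highest corner of the box over the bridge ending at \<open>r\<close>. It goes backwards only in direction \<open>i\<close>,
  by the length \<open>v - r\<close> of the gap; balance and the maximality of side \<open>i\<close> bound the gain in the other
  directions from below by \<open>s\<close> times the relative side \<open>i\<close>, which is what the domination hypothesis needs.
\<close>

lemma across_gap:
  assumes box: "bridge_box k a b" and bal: "balanced a b"
    and longest: "\<And>j. side a b j \<le> side a b i"
    and gap: "a $ i \<le> r" "r \<le> v" "v \<le> b $ i" "v - r \<le> \<kappa> * (b $ i - a $ i)"
  shows "f (\<chi> j. if j = i then v else a $ j) \<le> f (\<chi> j. if j = i then r else b $ j)"
    (is "f ?p \<le> f ?q")
proof (rule C1_le_along_segment[OF C1])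
  fix t :: real assume t: "0 \<le> t" "t \<le> 1"
  let ?x = "?p + t *\<^sub>R (?q - ?p)"
  have ab: "a $ j \<le> b $ j" for j using box by (auto simp: bridge_box_def less_imp_le)
  have "?p \<in> cart_prod (\<lambda>j. {a $ j..b $ j})" "?q \<in> cart_prod (\<lambda>j. {a $ j..b $ j})"
    using gap ab by (auto simp: cart_prod_def)
  then have x: "?x \<in> cart_prod (\<lambda>j. {A j..B j})"
    using segment_in_cart_prod t bridge_box_subset[OF box] by blast
  let ?L = "side a b i" and ?D = "\<lambda>j. partial j f ?x"
  have L: "0 < ?L" using box AB[of i] by (simp add: side_def bridge_box_def)
  have D: "0 < ?D j" for j using partial_pos[OF x] .
  have "(v - r) * ?D i \<le> \<kappa> * (b $ i - a $ i) * ?D i"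
    using gap(4) D by (intro mult_right_mono) (auto intro: less_imp_le)
  also have "\<dots> = ?L * (\<kappa> * (B i - A i) * ?D i)" unfolding side_eq by simp
  also have "\<dots> \<le> ?L * (s * (\<Sum>j\<in>UNIV - {i}. (B j - A j) * ?D j))"
    using domination[OF x] L by (intro mult_left_mono) auto
  also have "\<dots> = (\<Sum>j\<in>UNIV - {i}. s * ?L * ((B j - A j) * ?D j))"
    by (simp add: sum_distrib_left mult_ac)
  also have "\<dots> \<le> (\<Sum>j\<in>UNIV - {i}. (b $ j - a $ j) * ?D j)"
  proof (rule sum_mono)
    fix j
    have "s * ?L * ((B j - A j) * ?D j) \<le> side a b j * ((B j - A j) * ?D j)"
      using bal AB[of j] D[of j] by (intro mult_right_mono) (auto simp: balanced_def)
    then show "s * ?L * ((B j - A j) * ?D j) \<le> (b $ j - a $ j) * ?D j"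
      by (simp add: side_eq[of b j a] mult_ac)
  qed
  finally have "0 \<le> (r - v) * ?D i + (\<Sum>j\<in>UNIV - {i}. (b $ j - a $ j) * ?D j)"
    by (simp add: algebra_simps)
  also have "\<dots> = (\<Sum>j\<in>UNIV. (?q $ j - ?p $ j) * ?D j)"
    by (subst sum.remove[of UNIV i]) auto
  finally show "0 \<le> (\<Sum>j\<in>UNIV. (?q $ j - ?p $ j) * ?D j)" .
qed

text \<open>
Balance survives because the side that is split was the longest: it can fall to no less than \<open>s\<close>
  times the old maximum, every other side is already at least that long, and the maximum does not
  grow.
\<close>

lemma refine_longest_side:
  assumes box: "bridge_box k a b" and bal: "balanced a b" and y: "f a \<le> y" "y \<le> f b"
    and longest: "\<And>j. side a b j \<le> side a b i"
  obtains a' b' where "bridge_box (k(i := Suc (k i))) a' b'" "balanced a' b'" "f a' \<le> y" "y \<le> f b'"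
proof -
  let ?lo = "\<lambda>l. \<chi> j. if j = i then l else a $ j" and ?hi = "\<lambda>r. \<chi> j. if j = i then r else b $ j"
  have I: "{a $ i..b $ i} \<in> F i (k i)" "a $ i < b $ i" "1 \<le> k i" using box by (auto simp: bridge_box_def)
  obtain Us Js where sp: "splits {a $ i..b $ i} Us Js" "Js \<subseteq> F i (Suc (k i))" "Us \<subseteq> G i (Suc (k i))"
    using construction_split[OF construction I(1)] .
  have corner: "?lo (a $ i) = a" "?hi (b $ i) = b" by (simp_all add: vec_eq_iff)
  have gap: "f (?lo v) \<le> f (?hi r)" if U: "{r<..<v} \<in> Us" "r < v" for r v
  proof (rule across_gap[OF box bal longest])
    have sub: "{r<..<v} \<subseteq> {a $ i..b $ i}" using splits_gap[OF sp(1) U(1)] by metis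
    then show "a $ i \<le> r" "v \<le> b $ i" "r \<le> v"
      using U(2) by (auto simp: greaterThanLessThan_subseteq_atLeastAtMost_iff)
    have "open_interval {r<..<v}" using U(2) by (auto simp: open_interval_def)
    then have "len {r<..<v} \<le> \<kappa> * len {a $ i..b $ i}"
      using gap_ratio[OF I(1,3) subsetD[OF sp(3) U(1)] sub] by blast
    then show "v - r \<le> \<kappa> * (b $ i - a $ i)" using U I by simp
  qed
  have "f (?lo (a $ i)) \<le> y" "y \<le> f (?hi (b $ i))" unfolding corner using y .
  then obtain l r where lr: "{l..r} \<in> Js" "l < r" "f (?lo l) \<le> y" "y \<le> f (?hi r)"
    using splits_select_bridge[OF sp(1), of "\<lambda>x. f (?lo x)" y "\<lambda>x. f (?hi x)"] I(2) gap by auto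
  have sub: "{l..r} \<subseteq> {a $ i..b $ i}" using splits_subset[OF sp(1) lr(1)] .
  have "bridge_box (k(i := Suc (k i))) (?lo l) (?hi r)"
    using box lr sp(2) by (auto simp: bridge_box_def)
  moreover have "balanced (?lo l) (?hi r)"
  proof -
    let ?L = "side (?lo l) (?hi r)"
    have other: "?L j = side a b j" if "j \<noteq> i" for j using that by (simp add: side_def)
    have "s * (b $ i - a $ i) \<le> r - l"
      using bridge_ratio[OF I(1) _ sub] lr sp(2) I(2) by auto
    then have split_lower: "s * side a b i \<le> ?L i"
      using AB[of i] by (simp add: side_def divide_right_mono)
    have shrink: "?L j \<le> side a b j" for j
    proof (cases "j = i")
      case True
      have "r - l \<le> b $ i - a $ i" using sub lr(2) by auto
      then show ?thesis using True AB[of i] by (simp add: side_def divide_right_mono)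
    qed (simp add: other)
    have "s * ?L j \<le> ?L j'" for j j'
    proof -
      have "s * ?L j \<le> s * side a b i"
        using s_pos order_trans[OF shrink longest] by simp
      also have "\<dots> \<le> ?L j'"
        using bal split_lower other by (cases "j' = i") (auto simp: balanced_def)
      finally show ?thesis .
    qed
    then show ?thesis by (simp add: balanced_def)
  qed
  ultimately show ?thesis using that lr by blast
qed

lemma boxes_with_level_sum:
  assumes "bridge_box k a b" "balanced a b" "f a \<le> y" "y \<le> f b"
  shows "\<exists>k a b. bridge_box k a b \<and> balanced a b \<and> f a \<le> y \<and> y \<le> f b \<and> N \<le> (\<Sum>i\<in>UNIV. k i)"
proof (induction N)
  case 0
  then show ?case using assms by blast
next
  case (Suc N)
  then obtain k a b where IH: "bridge_box k a b" "balanced a b" "f a \<le> y" "y \<le> f b" "N \<le> (\<Sum>i\<in>UNIV. k i)"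
    by blast
  obtain i where longest: "\<And>j. side a b j \<le> side a b i"
  proof -
    have "Max (range (side a b)) \<in> range (side a b)" by (rule Max_in) auto
    then obtain i where i: "Max (range (side a b)) = side a b i" by blast
    show ?thesis
    proof (rule that)
      fix j show "side a b j \<le> side a b i" unfolding i[symmetric] by (rule Max_ge) auto
    qed
  qed
  obtain a' b' where new: "bridge_box (k(i := Suc (k i))) a' b'" "balanced a' b'" "f a' \<le> y" "y \<le> f b'"
    using refine_longest_side[OF IH(1-4) longest] .
  have "(\<Sum>j\<in>UNIV. (k(i := Suc (k i))) j) = Suc (\<Sum>j\<in>UNIV. k j)"
    by (subst (1 2) sum.remove[of UNIV i]) auto
  then show ?case using new IH(5) by (metis Suc_le_mono)
qed

text \<open>
Once the sum of the levels is large, some level \<open>k' i\<close> is at least \<open>M\<close>, which makes side \<open>i\<close> small.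
  By balance all sides are small, and a bridge of level \<open>k\<close> cannot be shorter than \<open>s ^ k\<close>
  relative to the hull, so small sides have high levels.
\<close>

lemma boxes_with_high_levels:
  assumes "bridge_box k a b" "balanced a b" "f a \<le> y" "y \<le> f b"
  obtains k' a' b' where "bridge_box k' a' b'" "f a' \<le> y" "y \<le> f b'" "\<And>i. n \<le> k' i"
proof -
  \<comment> \<open>The exponent \<open>Suc n\<close> absorbs the factor \<open>s\<close> lost in comparing two sides of a balanced box.\<close>
  obtain M where M: "(1 - s) ^ M < s ^ Suc n"
    using real_arch_pow_inv[of "s ^ Suc n" "1 - s"] s_pos by auto
  obtain k' a' b' where new: "bridge_box k' a' b'" "balanced a' b'" "f a' \<le> y" "y \<le> f b'"
    and sum: "CARD('n) * M \<le> (\<Sum>i\<in>UNIV. k' i)"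
    using boxes_with_level_sum[OF assms] by blast
  have "\<exists>i. M \<le> k' i"
  proof (rule ccontr)
    assume "\<not> ?thesis"
    then have "(\<Sum>i\<in>UNIV. k' i) < (\<Sum>i\<in>(UNIV::'n set). M)" by (intro sum_strict_mono) (auto simp: not_le)
    then show False using sum by simp
  qed
  then obtain i where i: "M \<le> k' i" by blast
  have bridge: "{a' $ j..b' $ j} \<in> F j (k' j)" "a' $ j < b' $ j" for j using new(1) by (auto simp: bridge_box_def)
  have "n \<le> k' j" for j
  proof -
    have "s ^ k' j \<le> side a' b' j"
      using bridge_side_lower[OF bridge] AB[of j] by (simp add: side_def pos_le_divide_eq)
    then have "s * s ^ k' j \<le> s * side a' b' j" using s_pos by simp
    also have "\<dots> \<le> side a' b' i" using new(2) by (simp add: balanced_def)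
    also have "\<dots> \<le> (1 - s) ^ k' i"
      using bridge_side_upper[OF bridge] AB[of i] by (simp add: side_def pos_divide_le_eq)
    also have "\<dots> \<le> (1 - s) ^ M" using i s_pos s_less_1 by (intro power_decreasing) auto
    finally have "s ^ Suc (k' j) < s ^ Suc n" using M by simp
    then show ?thesis using s_pos s_less_1 by (simp add: power_strict_decreasing_iff)
  qed
  then show ?thesis using that new by blast
qed

text \<open>
First-step boxes are balanced since their relative sides lie between \<open>s\<close> and 1.
\<close>

lemma first_bridge_box:
  assumes g: "\<And>i. g i \<in> F i 1"
  obtains a b where "bridge_box (\<lambda>i. 1) a b" "balanced a b" "\<And>i. g i = {a $ i..b $ i}"
proof -
  have "\<exists>l r. l < r \<and> g i = {l..r}" for i using construction_interval[OF construction g] by metis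
  then obtain l r where lr: "\<And>i. l i < r i" "\<And>i. g i = {l i..r i}" by metis
  let ?a = "\<chi> i. l i" and ?b = "\<chi> i. r i"
  have box: "bridge_box (\<lambda>i. 1) ?a ?b" using lr g by (auto simp: bridge_box_def)
  moreover have "balanced ?a ?b"
    unfolding balanced_def
  proof (intro allI)
    fix i j
    have bridge: "{?a $ j..?b $ j} \<in> F j 1" "?a $ j < ?b $ j" for j using box by (auto simp: bridge_box_def)
    have "side ?a ?b i \<le> 1 - s"
      using bridge_side_upper[OF bridge] AB[of i] by (simp add: side_def pos_divide_le_eq)
    then have "s * side ?a ?b i \<le> s * 1" using s_pos by (intro mult_left_mono) auto
    also have "s * 1 \<le> side ?a ?b j"
      using bridge_side_lower[OF bridge] AB[of j] by (simp add: side_def pos_le_divide_eq)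
    finally show "s * side ?a ?b i \<le> side ?a ?b j" .
  qed
  ultimately show ?thesis using that lr by simp
qed

section \<open>The image of the product\<close>

lemma image_cantor_sets:
  "f ` cart_prod (\<lambda>i. cantor_set (F i)) = f ` cart_prod (\<lambda>i. \<Union>(F i 1))"
proof
  show "f ` cart_prod (\<lambda>i. cantor_set (F i)) \<subseteq> f ` cart_prod (\<lambda>i. \<Union>(F i 1))"
    by (rule image_mono) (auto simp: cart_prod_def cantor_set_def)
  show "f ` cart_prod (\<lambda>i. \<Union>(F i 1)) \<subseteq> f ` cart_prod (\<lambda>i. cantor_set (F i))"
  proof
    fix y assume "y \<in> f ` cart_prod (\<lambda>i. \<Union>(F i 1))"
    then obtain x where x: "x \<in> cart_prod (\<lambda>i. \<Union>(F i 1))" "y = f x" by blast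
    then have "\<exists>I. I \<in> F i 1 \<and> x $ i \<in> I" for i by (auto simp: cart_prod_def)
    then obtain g where g: "\<And>i. g i \<in> F i 1" "\<And>i. x $ i \<in> g i" by metis
    obtain a b where ab: "bridge_box (\<lambda>i. 1) a b" "balanced a b" "\<And>i. g i = {a $ i..b $ i}"
      using first_bridge_box[OF g(1)] by blast
    have "y \<in> f ` cart_prod (\<lambda>i. {a $ i..b $ i})" using x g ab(3) by (auto simp: cart_prod_def)
    then have y: "f a \<le> y" "y \<le> f b" using image_bridge_box[OF ab(1)] by auto
    define S where "S n = cart_prod (\<lambda>i. \<Union>(F i n)) \<inter> f -` {y}" for n
    have "\<Inter>(range S) \<noteq> {}"
    proof (rule compact_nest)
      fix n
      have "compact (\<Union>(F i n))" for i
      proof (rule compact_Union)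
        show "finite (F i n)" using construction_stage[OF construction] by blast
        show "compact I" if "I \<in> F i n" for I
          using construction_interval[OF construction that] by (metis compact_Icc)
      qed
      then have "compact (cart_prod (\<lambda>i. \<Union>(F i n)))" by (rule compact_cart_prod)
      moreover have "closed (f -` {y})" using continuous_f by (intro closed_vimage) auto
      ultimately show "compact (S n)" unfolding S_def by (rule compact_Int_closed)
      obtain k' a' b' where new: "bridge_box k' a' b'" "f a' \<le> y" "y \<le> f b'" "\<And>i. n \<le> k' i"
        using boxes_with_high_levels[OF ab(1,2) y] by metis
      then have "y \<in> f ` cart_prod (\<lambda>i. {a' $ i..b' $ i})" using image_bridge_box[OF new(1)] by simp
      then obtain z where z: "z \<in> cart_prod (\<lambda>i. {a' $ i..b' $ i})" "f z = y" by blast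
      have "z $ i \<in> \<Union>(F i n)" for i
      proof -
        have "z $ i \<in> {a' $ i..b' $ i}" using z(1) by (simp add: cart_prod_def)
        moreover have "{a' $ i..b' $ i} \<in> F i (k' i)" using new(1) by (simp add: bridge_box_def)
        ultimately have "z $ i \<in> \<Union>(F i (k' i))" by blast
        then show ?thesis using construction_antimono[OF construction new(4)] by blast
      qed
      then show "S n \<noteq> {}" using z by (auto simp: S_def cart_prod_def)
    next
      fix m n :: nat assume "m \<le> n"
      then show "S n \<subseteq> S m" using construction_antimono[OF construction] by (fastforce simp: S_def cart_prod_def)
    qed
    then obtain z where "\<And>n. z \<in> S n" by blast
    then have "z \<in> cart_prod (\<lambda>i. cantor_set (F i))" "f z = y"
      by (auto simp: S_def cart_prod_def cantor_set_def)
    then show "y \<in> f ` cart_prod (\<lambda>i. cantor_set (F i))" by blast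
  qed
qed

text \<open>
Each of the finitely many first-step boxes contributes one interval, which is nondegenerate
  because \<open>f\<close> strictly increases from the lowest to the highest corner.
\<close>

lemma image_first_stage:
  "\<exists>Js. finite Js \<and> (\<forall>J\<in>Js. closed_interval J) \<and> f ` cart_prod (\<lambda>i. \<Union>(F i 1)) = \<Union>Js"
proof -
  let ?Js = "(\<lambda>g. f ` cart_prod g) ` {g. \<forall>i. g i \<in> F i 1}"
  have "finite (F i 1)" for i using construction_stage[OF construction] by blast
  then have "finite {g. \<forall>i. g i \<in> F i 1}"
    using finite_PiE[of UNIV "\<lambda>i. F i 1"] by (simp add: PiE_UNIV_domain Pi_def)
  then have "finite ?Js" by blast
  moreover have "closed_interval (f ` cart_prod g)" if g: "\<And>i. g i \<in> F i 1" for g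
  proof -
    obtain a b where ab: "bridge_box (\<lambda>i. 1) a b" "balanced a b" "\<And>i. g i = {a $ i..b $ i}"
      using first_bridge_box[OF g] by blast
    have "f ` cart_prod g = {f a..f b}" using image_bridge_box[OF ab(1)] ab(3) by (simp add: cart_prod_def)
    moreover have "f a < f b"
      using f_strict_mono[OF bridge_box_corners[OF ab(1)]] ab(1) by (simp add: bridge_box_def)
    ultimately show ?thesis by (auto simp: closed_interval_def)
  qed
  moreover have "cart_prod (\<lambda>i. \<Union>(F i 1)) = \<Union>(cart_prod ` {g. \<forall>i. g i \<in> F i 1})"
  proof (intro equalityI subsetI)
    fix x assume "x \<in> cart_prod (\<lambda>i. \<Union>(F i 1))"
    then have "\<exists>I. I \<in> F i 1 \<and> x $ i \<in> I" for i by (auto simp: cart_prod_def)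
    then obtain g where "\<And>i. g i \<in> F i 1" "\<And>i. x $ i \<in> g i" by metis
    then show "x \<in> \<Union>(cart_prod ` {g. \<forall>i. g i \<in> F i 1})" by (auto simp: cart_prod_def)
  qed (auto simp: cart_prod_def)
  ultimately show ?thesis by (intro exI[of _ ?Js]) (auto simp: image_UN)
qed

end

theorem theorem1p4:
  fixes f :: "real^'n::finite \<Rightarrow> real"
    and A B :: "'n \<Rightarrow> real"
    and F G :: "'n \<Rightarrow> nat \<Rightarrow> real set set"
  assumes "CARD('n) \<ge> 2"
    and "C1 f"
    and "\<And>i. cantor_construction (A i) (B i) (F i) (G i)"
    and "\<And>i x. x \<in> cart_prod (\<lambda>j. {A j..B j}) \<Longrightarrow> partial i f x > 0"
    and "\<And>i x. x \<in> cart_prod (\<lambda>j. {A j..B j}) \<Longrightarrow>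
           s_min F * (\<Sum>j\<in>UNIV - {i}. (B j - A j) * partial j f x)
             - kappa F G * (B i - A i) * partial i f x \<ge> 0"
  shows "f ` cart_prod (\<lambda>i. cantor_set (F i)) = f ` cart_prod (\<lambda>i. \<Union>(F i 1)) \<and>
    (\<exists>Js. finite Js \<and> (\<forall>J\<in>Js. closed_interval J) \<and>
      f ` cart_prod (\<lambda>i. cantor_set (F i)) = \<Union>Js)"
proof -
  have AB: "A i < B i" for i using assms(3)[of i] by (simp add: cantor_construction_def)
  \<comment> \<open>Gaps have positive length, so the hypothesis could not hold with \<open>s_min F = 0\<close>.\<close>
  have "s_min F \<noteq> 0"
  proof
    fix i assume 0: "s_min F = 0"
    have a: "(\<chi> j. A j) \<in> cart_prod (\<lambda>j. {A j..B j})" using AB by (auto simp: cart_prod_def less_imp_le)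
    have "0 < kappa F G * (B i - A i) * partial i f (\<chi> j. A j)"
      using kappa_pos[where F = F and G = G, OF assms(3)] AB[of i] assms(4)[OF a, of i] by simp
    then show False using assms(5)[OF a, of i] 0 by simp
  qed
  then have "0 < s_min F" using s_min_nonneg[where F = F, OF assms(3)] by simp
  then interpret gap_dominated f A B F G "s_min F" "kappa F G"
    using assms s_min_le[where F = F, OF assms(3)] kappa_ge[where F = F and G = G, OF assms(3)]
    by unfold_locales auto
  show ?thesis using image_cantor_sets image_first_stage by simp
qed

end
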